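(* Let $\mathcal M=(E,\rho)$ be a $q$-matroid, fix a non-degenerate symmetric bilinear form on $E$, and let $W,V\le E$ with $W\oplus V=E$. Let $S=\{\langle w_1\rangle,\dots,\langle w_t\rangle\}\subseteq\mathbb PE$ where $\{w_1,\dots,w_t\}$ is a basis of $W$, and let $\mathcal Q_V=\mathbb PE-P(V)$ (the lines not contained in $V$). Then $$P(\mathcal M/W)\cong\big(P(\mathcal M)/S\big)\setminus(\mathcal Q_V-S)\qquad\text{and}\qquad P(\mathcal M\setminus V^\perp)\cong P(\mathcal M)\setminus\mathcal Q_V$$ as matroids.
   Context: A $q$-matroid is a pair $(E,\rho)$ where $E$ is a finite-dimensional vector space over the finite field $\mathbb F_q$ and $\rho$ assigns to each subspace a nonnegative integer with $0\le\rho(U)\le\dim U$, monotonicity, and submodularity $\rho(U+U')+\rho(U\cap U')\le\rho(U)+\rho(U')$. $\mathbb PE$ is the set of $1$-dimensional subspaces of $E$; $P(U)=\{\langle u\rangle:u\in U-\{0\}\}$; for $A\subseteq\mathbb PE$, $\langle A\rangle$ is the span of the union of the lines in $A$. The projectivization matroid is $P(\mathcal M)=(\mathbb PE,r)$ with $r(A)=\rho(\langle A\rangle)$. $U^\perp$ is the orthogonal complement with respect to the fixed form. Deletion: $\mathcal M\setminus U=(U^\perp,\rho|)$ (so $\mathcal M\setminus V^\perp$ has groundspace $V$). Contraction: $\mathcal M/U=(E/U,\rho')$, $\rho'(X)=\rho(\pi^{-1}(X))-\rho(U)$ with $\pi:E\to E/U$. Matroid deletion $M\setminus A=(S-A,r|)$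 and contraction $M/A=(S-A,r')$ with $r'(B)=r(B\cup A)-r(A)$. Two matroids are equivalent ($\cong$) if there is a bijection between groundsets preserving rank. *)

theory Defs
  imports "HOL-Algebra.AbelCoset" "Jordan_Normal_Form.Missing_VectorSpace"
begin

section \<open>Matroids given by a rank function\<close>

text \<open>
  A matroid is a pair of a ground set and a rank function, a \<open>q\<close>-matroid a pair of a ground space
  and a rank function.  A rank function is a total HOL function of which only the values on subsets
  of the ground set (on subspaces of the ground space) matter, so restricting it to a smaller
  ground set does not change it as a HOL function.
\<close>

type_synonym 's matroid = "'s set \<times> ('s set \<Rightarrow> nat)"

definition is_matroid :: "'s matroid \<Rightarrow> bool" where
  "is_matroid = (\<lambda>(S, r).
     finite S \<and>
     (\<forall>A. A \<subseteq> S \<longrightarrow> r A \<le> card A) \<and>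
     (\<forall>A B. A \<subseteq> B \<longrightarrow> B \<subseteq> S \<longrightarrow> r A \<le> r B) \<and>
     (\<forall>A B. A \<subseteq> S \<longrightarrow> B \<subseteq> S \<longrightarrow> r (A \<union> B) + r (A \<inter> B) \<le> r A + r B))"

definition matroid_delete :: "'s matroid \<Rightarrow> 's set \<Rightarrow> 's matroid" where
  "matroid_delete = (\<lambda>(S, r) A. (S - A, r))"

text \<open>The truncated subtraction is harmless here, and in \<open>q_contract\<close> below, by monotonicity.\<close>

definition matroid_contract :: "'s matroid \<Rightarrow> 's set \<Rightarrow> 's matroid" where
  "matroid_contract = (\<lambda>(S, r) A. (S - A, \<lambda>B. r (B \<union> A) - r A))"

text \<open>Equivalence is a relation between matroids, hence includes that both sides are matroids.\<close>

definition matroid_equiv :: "'s matroid \<Rightarrow> 't matroid \<Rightarrow> bool" (infix \<open>\<cong>\<^sub>m\<close> 50) where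
  "M \<cong>\<^sub>m N \<longleftrightarrow> is_matroid M \<and> is_matroid N \<and>
     (\<exists>f. bij_betw f (fst M) (fst N) \<and> (\<forall>A. A \<subseteq> fst M \<longrightarrow> snd N (f ` A) = snd M A))"

section \<open>Quotient spaces and bilinear forms\<close>

text \<open>
  The vector space of cosets of \<open>U\<close>.  The fields \<open>mult\<close> and \<open>one\<close> of the record are not part of
  the vector space structure.  As in \<open>rcoset_mult\<close>, the scalar multiple of a coset is formed from
  all its representatives; the coset \<open>U +> a x\<close> does not depend on the representative \<open>x\<close>.
\<close>

definition quotient_space :: "('a, 'b) module \<Rightarrow> 'b set \<Rightarrow> ('a, 'b set) module" where
  "quotient_space E U =
     \<lparr>carrier = a_rcosets\<^bsub>E\<^esub> U, mult = (\<lambda>_ _. U), one = U, zero = U, add = set_add E,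
      smult = (\<lambda>a X. \<Union>x\<in>X. U +>\<^bsub>E\<^esub> (a \<odot>\<^bsub>E\<^esub> x))\<rparr>"

locale nondegenerate_symmetric_form = vectorspace K E
  for K :: "('a, 'k) ring_scheme" and E :: "('a, 'b) module" +
  fixes \<beta> :: "'b \<Rightarrow> 'b \<Rightarrow> 'a"
  assumes form_closed: "\<lbrakk>x \<in> carrier E; y \<in> carrier E\<rbrakk> \<Longrightarrow> \<beta> x y \<in> carrier K"
    and form_add_left: "\<lbrakk>x \<in> carrier E; y \<in> carrier E; z \<in> carrier E\<rbrakk>
      \<Longrightarrow> \<beta> (x \<oplus>\<^bsub>E\<^esub> y) z = \<beta> x z \<oplus>\<^bsub>K\<^esub> \<beta> y z"
    and form_add_right: "\<lbrakk>x \<in> carrier E; y \<in> carrier E; z \<in> carrier E\<rbrakk>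
      \<Longrightarrow> \<beta> x (y \<oplus>\<^bsub>E\<^esub> z) = \<beta> x y \<oplus>\<^bsub>K\<^esub> \<beta> x z"
    and form_smult_left: "\<lbrakk>a \<in> carrier K; x \<in> carrier E; y \<in> carrier E\<rbrakk>
      \<Longrightarrow> \<beta> (a \<odot>\<^bsub>E\<^esub> x) y = a \<otimes>\<^bsub>K\<^esub> \<beta> x y"
    and form_smult_right: "\<lbrakk>a \<in> carrier K; x \<in> carrier E; y \<in> carrier E\<rbrakk>
      \<Longrightarrow> \<beta> x (a \<odot>\<^bsub>E\<^esub> y) = a \<otimes>\<^bsub>K\<^esub> \<beta> x y"
    and form_sym: "\<lbrakk>x \<in> carrier E; y \<in> carrier E\<rbrakk> \<Longrightarrow> \<beta> x y = \<beta> y x"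
    and form_nondegenerate: "\<lbrakk>x \<in> carrier E; \<And>y. y \<in> carrier E \<Longrightarrow> \<beta> x y = \<zero>\<^bsub>K\<^esub>\<rbrakk>
      \<Longrightarrow> x = \<zero>\<^bsub>E\<^esub>"

definition orth_compl ::
  "('a, 'k) ring_scheme \<Rightarrow> ('a, 'b) module \<Rightarrow> ('b \<Rightarrow> 'b \<Rightarrow> 'a) \<Rightarrow> 'b set \<Rightarrow> 'b set" where
  "orth_compl K E \<beta> U = {x \<in> carrier E. \<forall>u\<in>U. \<beta> x u = \<zero>\<^bsub>K\<^esub>}"

section \<open>\<open>q\<close>-matroids\<close>

text \<open>The prime power \<open>q\<close> is the number of elements of the finite field \<open>K\<close>.\<close>

type_synonym ('a, 'b) qmatroid = "('a, 'b) module \<times> ('b set \<Rightarrow> nat)"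

locale q_matroid = vectorspace K E
  for K :: "('a, 'k) ring_scheme" and E :: "('a, 'b) module" +
  fixes \<rho> :: "'b set \<Rightarrow> nat"
  assumes finite_field: "finite (carrier K)"
    and finite_dim: "fin_dim"
    and rank_le_dim: "subspace K U E \<Longrightarrow> \<rho> U \<le> vectorspace.dim K (E\<lparr>carrier := U\<rparr>)"
    and rank_mono: "\<lbrakk>subspace K U E; subspace K U' E; U \<subseteq> U'\<rbrakk> \<Longrightarrow> \<rho> U \<le> \<rho> U'"
    and rank_submodular: "\<lbrakk>subspace K U E; subspace K U' E\<rbrakk>
      \<Longrightarrow> \<rho> (subspace_sum U U') + \<rho> (U \<inter> U') \<le> \<rho> U + \<rho> U'"

definition q_delete ::
  "('a, 'k) ring_scheme \<Rightarrow> ('b \<Rightarrow> 'b \<Rightarrow> 'a) \<Rightarrow> ('a, 'b) qmatroid \<Rightarrow> 'b set \<Rightarrow> ('a, 'b) qmatroid" where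
  "q_delete K \<beta> = (\<lambda>(E, \<rho>) U. (E\<lparr>carrier := orth_compl K E \<beta> U\<rparr>, \<rho>))"

definition q_contract :: "('a, 'b) qmatroid \<Rightarrow> 'b set \<Rightarrow> ('a, 'b set) qmatroid" where
  "q_contract = (\<lambda>(E, \<rho>) U.
     (quotient_space E U, \<lambda>X. \<rho> {x \<in> carrier E. U +>\<^bsub>E\<^esub> x \<in> X} - \<rho> U))"

definition proj_space :: "('a, 'k) ring_scheme \<Rightarrow> ('a, 'b) module \<Rightarrow> 'b set set" where
  "proj_space K E = {L. subspace K L E \<and> vectorspace.dim K (E\<lparr>carrier := L\<rparr>) = 1}"

definition proj_points :: "('a, 'k) ring_scheme \<Rightarrow> ('a, 'b) module \<Rightarrow> 'b set \<Rightarrow> 'b set set" where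
  "proj_points K E U = {module.span K E {u} | u. u \<in> U - {\<zero>\<^bsub>E\<^esub>}}"

definition projectivization :: "('a, 'k) ring_scheme \<Rightarrow> ('a, 'b) qmatroid \<Rightarrow> 'b set matroid" where
  "projectivization K = (\<lambda>(E, \<rho>). (proj_space K E, \<lambda>A. \<rho> (module.span K E (\<Union>A))))"

end

theory Submission
  imports Defs
begin

text \<open>
  For the contraction, the coset map \<open>\<pi>\<close> restricts to an isomorphism from \<open>V\<close> onto \<open>E/W\<close>, because \<open>V\<close>
  is a complement of \<open>W\<close>, so \<open>L \<mapsto> \<pi>(L)\<close> is a bijection from \<open>P(V)\<close> onto the points of \<open>E/W\<close>.  No point
  of \<open>S\<close> lies in \<open>V\<close>, hence \<open>P(V)\<close> is the ground set on the matroid side.  The ranks agree because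
  \<open>\<pi>\<^sup>-\<^sup>1\<langle>\<pi>(A)\<rangle> = W + \<langle>A\<rangle> = \<langle>S \<union> A\<rangle>\<close>.  For the deletion, \<open>V\<^sup>\<bottom>\<^sup>\<bottom> = V\<close>, and both sides are the same
  matroid on \<open>P(V)\<close>.
\<close>

section \<open>Matroids\<close>

lemma is_matroid_delete:
  assumes "is_matroid M"
  shows "is_matroid (matroid_delete M A)"
proof -
  obtain S r where M: "M = (S, r)" by (cases M)
  have sub: "B \<subseteq> S" if "B \<subseteq> S - A" for B using that by blast
  show ?thesis
    using assms unfolding M is_matroid_def matroid_delete_def
    by (simp add: sub)
qed

text \<open>Submodularity at \<open>B\<close> and \<open>A\<close> gives the bound by
  \<open>card B\<close>. Submodularity of the contracted rank is that of \<open>r\<close> at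
  \<open>B \<union> A\<close> and \<open>C \<union> A\<close>, since adjoining \<open>A\<close>
  commutes with unions and intersections.\<close>

lemma is_matroid_contract:
  assumes "is_matroid M" and A: "A \<subseteq> fst M"
  shows "is_matroid (matroid_contract M A)"
proof -
  obtain S r where M: "M = (S, r)" by (cases M)
  have fin: "finite S" and card: "\<And>B. B \<subseteq> S \<Longrightarrow> r B \<le> card B"
    and mono: "\<And>B C. B \<subseteq> C \<Longrightarrow> C \<subseteq> S \<Longrightarrow> r B \<le> r C"
    and submod: "\<And>B C. B \<subseteq> S \<Longrightarrow> C \<subseteq> S \<Longrightarrow> r (B \<union> C) + r (B \<inter> C) \<le> r B + r C"
    using assms(1) by (auto simp: M is_matroid_def)
  have AS: "A \<subseteq> S" using A by (simp add: M)
  have "r (B \<union> A) - r A \<le> card B" if "B \<subseteq> S" for B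
    using submod[OF that AS] card[OF that] by linarith
  moreover have "r (B \<union> A) - r A \<le> r (C \<union> A) - r A" if "B \<subseteq> C" "C \<subseteq> S" for B C
    by (rule diff_le_mono, rule mono) (use that AS in auto)
  moreover have "(r (B \<union> C \<union> A) - r A) + (r (B \<inter> C \<union> A) - r A)
      \<le> (r (B \<union> A) - r A) + (r (C \<union> A) - r A)" if "B \<subseteq> S" "C \<subseteq> S" for B C
  proof -
    have "(B \<union> A) \<union> (C \<union> A) = B \<union> C \<union> A" "(B \<union> A) \<inter> (C \<union> A) = B \<inter> C \<union> A"
      by auto
    then have "r (B \<union> C \<union> A) + r (B \<inter> C \<union> A) \<le> r (B \<union> A) + r (C \<union> A)"
      using submod[of "B \<union> A" "C \<union> A"] that AS by auto
    \<comment> \<open>Monotonicity makes the truncated subtractions exact, so twice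
      \<open>r A\<close> can be taken from both sides.\<close>
    moreover have "r A \<le> r (B \<union> A)" "r A \<le> r (C \<union> A)" "r A \<le> r (B \<inter> C \<union> A)"
      "r A \<le> r (B \<union> C \<union> A)"
      using that AS by (auto intro!: mono)
    ultimately show ?thesis by linarith
  qed
  ultimately show ?thesis
    unfolding M is_matroid_def matroid_contract_def using fin
    by (simp add: subset_iff)
qed

text \<open>
  Only \<open>N\<close> has to be known to be a matroid; this is why the contracted and deleted \<open>q\<close>-matroids
  need not be shown to be \<open>q\<close>-matroids.
\<close>

lemma matroid_equivI:
  assumes N: "is_matroid N" and bij: "bij_betw g (fst N) (fst M)"
    and rank: "\<And>A. A \<subseteq> fst N \<Longrightarrow> snd M (g ` A) = snd N A"
  shows "M \<cong>\<^sub>m N"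
proof -
  obtain S r where M: "M = (S, r)" by (cases M)
  obtain T s where N': "N = (T, s)" by (cases N)
  have inj: "inj_on g T" and im: "g ` T = S"
    using bij by (auto simp: M N' bij_betw_def)
  \<comment> \<open>Subsets of the two ground sets correspond under \<open>g\<close>, so each axiom
    for \<open>M\<close> is pulled back to \<open>N\<close>.\<close>
  have ex: "\<exists>A'. A' \<subseteq> T \<and> A = g ` A'" if "A \<subseteq> S" for A
    using that im by (metis subset_imageE)
  have rk: "r (g ` A) = s A" if "A \<subseteq> T" for A using rank that by (simp add: M N')
  have fin: "finite T" and card: "\<And>B. B \<subseteq> T \<Longrightarrow> s B \<le> card B"
    and mono: "\<And>B C. B \<subseteq> C \<Longrightarrow> C \<subseteq> T \<Longrightarrow> s B \<le> s C"
    and submod: "\<And>B C. B \<subseteq> T \<Longrightarrow> C \<subseteq> T \<Longrightarrow> s (B \<union> C) + s (B \<inter> C) \<le> s B + s C"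
    using N by (auto simp: N' is_matroid_def)
  have "r A \<le> card A" if "A \<subseteq> S" for A
    using ex[OF that] card rk by (metis card_image inj inj_on_subset)
  moreover have "r A \<le> r B" if AB: "A \<subseteq> B" "B \<subseteq> S" for A B
  proof -
    obtain A' B' where AB': "A' \<subseteq> T" "A = g ` A'" "B' \<subseteq> T" "B = g ` B'"
      using ex[OF subset_trans[OF AB]] ex[OF AB(2)] by blast
    with AB(1) have "A' \<subseteq> B'" using AB' inj by (auto simp: inj_on_def subset_iff image_iff) (metis (no_types))
    with AB' show ?thesis by (simp add: rk mono)
  qed
  moreover have "r (A \<union> B) + r (A \<inter> B) \<le> r A + r B" if AB: "A \<subseteq> S" "B \<subseteq> S" for A B
  proof -
    obtain A' B' where AB': "A' \<subseteq> T" "A = g ` A'" "B' \<subseteq> T" "B = g ` B'"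
      using ex[OF AB(1)] ex[OF AB(2)] by blast
    then have "A \<union> B = g ` (A' \<union> B')" "A \<inter> B = g ` (A' \<inter> B')"
      by (auto simp: inj_on_image_Int[OF inj])
    moreover have "A' \<union> B' \<subseteq> T" "A' \<inter> B' \<subseteq> T" using AB' by auto
    ultimately show ?thesis using AB' submod[of A' B'] by (simp add: rk)
  qed
  ultimately have "is_matroid M"
    using fin im unfolding M is_matroid_def by (auto simp: subset_iff)
  \<comment> \<open>\<open>matroid_equiv\<close> asks for a map from \<open>M\<close> to
    \<open>N\<close>, while \<open>g\<close> runs the other way; its inverse is the
    equivalence.\<close>
  moreover have "bij_betw (the_inv_into T g) S T"
    using bij by (simp add: M N' bij_betw_the_inv_into)
  moreover have "s (the_inv_into T g ` A) = r A" if A: "A \<subseteq> S" for A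
  proof -
    obtain A' where A': "A' \<subseteq> T" "A = g ` A'" using ex[OF A] by blast
    then have "the_inv_into T g ` A = A'"
      using inj by (force simp: image_image the_inv_into_f_f subset_iff)
    with A' rk show ?thesis by simp
  qed
  ultimately show ?thesis
    using N unfolding matroid_equiv_def by (auto simp: M N')
qed

section \<open>Linear algebra\<close>

lemma (in vectorspace) subspace_zero: "subspace K U V \<Longrightarrow> \<zero>\<^bsub>V\<^esub> \<in> U"
  by (simp add: subspace_def submodule_def)

lemma (in vectorspace) subspace_subset: "subspace K U V \<Longrightarrow> U \<subseteq> carrier V"
  by (simp add: subspace_def submodule_def)

lemma (in vectorspace) subspace_add:
  "subspace K U V \<Longrightarrow> x \<in> U \<Longrightarrow> y \<in> U \<Longrightarrow> x \<oplus>\<^bsub>V\<^esub> y \<in> U"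
  by (simp add: subspace_def submodule_def)

lemma (in vectorspace) subspace_smult:
  "subspace K U V \<Longrightarrow> a \<in> carrier K \<Longrightarrow> x \<in> U \<Longrightarrow> a \<odot>\<^bsub>V\<^esub> x \<in> U"
  by (simp add: subspace_def submodule_def)

lemma (in vectorspace) subspace_uminus:
  assumes "subspace K U V" "x \<in> U"
  shows "\<ominus>\<^bsub>V\<^esub> x \<in> U"
  using subspace_smult[OF assms(1) _ assms(2), of "\<ominus>\<^bsub>K\<^esub> \<one>\<^bsub>K\<^esub>"] subspace_subset[OF assms(1)] assms(2)
  by (simp add: smult_minus_1 subset_iff)

lemma (in vectorspace) subspaceI:
  assumes "U \<subseteq> carrier V" "\<zero>\<^bsub>V\<^esub> \<in> U"
    and "\<And>x y. x \<in> U \<Longrightarrow> y \<in> U \<Longrightarrow> x \<oplus>\<^bsub>V\<^esub> y \<in> U"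
    and "\<And>a x. a \<in> carrier K \<Longrightarrow> x \<in> U \<Longrightarrow> a \<odot>\<^bsub>V\<^esub> x \<in> U"
  shows "subspace K U V"
  using assms vectorspace_axioms module_axioms
  by (simp add: subspace_def submodule_def)

lemma (in vectorspace) subspace_Int:
  "subspace K U V \<Longrightarrow> subspace K U' V \<Longrightarrow> subspace K (U \<inter> U') V"
  by (rule subspaceI) (auto simp: subspace_zero subspace_add subspace_smult dest: subspace_subset)

lemma (in vectorspace) span_least:
  "subspace K U V \<Longrightarrow> A \<subseteq> U \<Longrightarrow> span A \<subseteq> U"
  by (rule span_is_subset) auto

lemma (in vectorspace) span_vs:
  "subspace K U V \<Longrightarrow> A \<subseteq> U \<Longrightarrow> LinearCombinations.module.span K (V\<lparr>carrier := U\<rparr>) A = span A"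
  by (rule span_li_not_depend) auto

text \<open>Every vector is a linear combination of a finite generating set, and over a finite field
  there are finitely many coefficient functions on that set.\<close>

lemma (in vectorspace) finite_carrier:
  assumes "finite (carrier K)" and "fin_dim"
  shows "finite (carrier V)"
proof -
  obtain A where A: "finite A" "A \<subseteq> carrier V" "gen_set A"
    using assms(2) unfolding fin_dim_def by blast
  have "carrier V \<subseteq> (\<lambda>a. lincomb a A) ` (A \<rightarrow>\<^sub>E carrier K)"
  proof
    fix v assume "v \<in> carrier V"
    then obtain a where a: "a \<in> A \<rightarrow> carrier K" "lincomb a A = v"
      using A finite_in_span by metis
    \<comment> \<open>Values of \<open>a\<close> outside \<open>A\<close> are arbitrary;
      \<open>restrict\<close> fixes them and so lands in a finite set of functions.\<close>
    moreover have "lincomb (restrict a A) A = lincomb a A"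
      using A a by (intro lincomb_cong) auto
    ultimately show "v \<in> (\<lambda>a. lincomb a A) ` (A \<rightarrow>\<^sub>E carrier K)"
      by (intro image_eqI[of _ _ "restrict a A"]) auto
  qed
  then show ?thesis
    using assms(1) A(1) by (meson finite_PiE finite_imageI finite_subset)
qed

lemma (in vectorspace) fin_dim_if_finite_carrier: "finite (carrier V) \<Longrightarrow> fin_dim"
  unfolding fin_dim_def using in_own_span[of "carrier V"] span_is_subset2[of "carrier V"] by blast

text \<open>Inside its own span, \<open>A\<close> is a generating set, and a generating set has at
  least as many elements as the dimension.\<close>

lemma (in vectorspace) dim_vs_span_le:
  assumes "finite A" "A \<subseteq> carrier V"
  shows "vectorspace.dim K (V\<lparr>carrier := span A\<rparr>) \<le> card A"
proof -
  have sub: "subspace K (span A) V" using assms(2) by (rule span_is_subspace)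
  interpret U: vectorspace K "V\<lparr>carrier := span A\<rparr>" using sub by (rule subspace_is_vs)
  have "A \<subseteq> span A" using assms(2) by (rule in_own_span)
  then show ?thesis
    using assms(1) by (intro U.gen_ge_dim) (auto simp: span_vs[OF sub])
qed

lemma (in vectorspace) dim_vs_span_singleton:
  assumes "v \<in> carrier V" "v \<noteq> \<zero>\<^bsub>V\<^esub>"
  shows "vectorspace.dim K (V\<lparr>carrier := span {v}\<rparr>) = 1"
proof -
  have sub: "subspace K (span {v}) V" using assms by (intro span_is_subspace) auto
  interpret U: vectorspace K "V\<lparr>carrier := span {v}\<rparr>" using sub by (rule subspace_is_vs)
  show ?thesis
    using assms span_self[OF assms(1)]
    by (intro U.dim1I[of v]) (auto simp: span_vs[OF sub])
qed

text \<open>Independent sets have at most \<open>dim\<close> elements, so a maximal independent set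
  above \<open>C\<close> exists. It is maximal among all independent sets, because any set above it
  also contains \<open>C\<close>.\<close>

lemma (in vectorspace) basis_extension:
  assumes "fin_dim" "lin_indpt C" "C \<subseteq> carrier V"
  obtains B where "finite B" "C \<subseteq> B" "basis B"
proof -
  have "\<exists>B. finite B \<and> maximal B (\<lambda>S. S \<subseteq> carrier V \<and> lin_indpt S \<and> C \<subseteq> S)"
    by (rule maximal_exists[of _ "dim" C]) (use assms li_le_dim in auto)
  then obtain B where B: "finite B" "maximal B (\<lambda>S. S \<subseteq> carrier V \<and> lin_indpt S \<and> C \<subseteq> S)"
    by blast
  then have "maximal B (\<lambda>S. S \<subseteq> carrier V \<and> lin_indpt S)"
    unfolding maximal_def by blast
  then have "basis B" by (rule max_li_is_basis)
  with B that show ?thesis by (auto simp: maximal_def)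
qed

text \<open>Coordinates are unique only once their values outside \<open>B\<close> are fixed, hence
  the extensional functions. The purpose is counting: the space has as many vectors as there are
  functions from a basis to \<open>K\<close>.\<close>

lemma (in vectorspace) bij_betw_lincomb_basis:
  assumes "basis B" "finite B"
  shows "bij_betw (\<lambda>a. lincomb a B) (B \<rightarrow>\<^sub>E carrier K) (carrier V)"
proof -
  have B: "B \<subseteq> carrier V" using assms(1) by (simp add: basis_def)
  have *: "\<forall>v. v \<in> carrier V \<longrightarrow> (\<exists>!a. a \<in> B \<rightarrow>\<^sub>E carrier K \<and> lincomb a B = v)"
    using assms basis_criterion[OF assms(2) B] by blast
  have cl: "lincomb a B \<in> carrier V" if "a \<in> B \<rightarrow>\<^sub>E carrier K" for a
    using that B by (intro lincomb_closed) auto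
  show ?thesis
  proof (rule bij_betw_imageI)
    show "inj_on (\<lambda>a. lincomb a B) (B \<rightarrow>\<^sub>E carrier K)"
      using * cl by (intro inj_onI) blast
    show "(\<lambda>a. lincomb a B) ` (B \<rightarrow>\<^sub>E carrier K) = carrier V"
    proof
      show "carrier V \<subseteq> (\<lambda>a. lincomb a B) ` (B \<rightarrow>\<^sub>E carrier K)" using * by blast
    qed (use cl in blast)
  qed
qed

text \<open>Both inclusions use minimality of spans: the preimage of a subspace under
  \<open>T\<close> is a subspace, and so is the image of one.\<close>

lemma (in vectorspace) image_span:
  assumes "linear_map K V V' T" and A: "A \<subseteq> carrier V"
  shows "T ` span A = LinearCombinations.module.span K V' (T ` A)"
proof
  interpret V': vectorspace K V' using assms(1) by (simp add: linear_map_def)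
  interpret T: linear_map K V V' T by fact
  have TA: "T ` A \<subseteq> carrier V'" using A by auto
  have sA: "subspace K (span A) V" using A by (rule span_is_subspace)
  have sTA: "subspace K (V'.span (T ` A)) V'" using TA by (rule V'.span_is_subspace)
  have "subspace K {x \<in> carrier V. T x \<in> V'.span (T ` A)} V"
    by (rule subspaceI)
      (simp_all add: V'.subspace_zero[OF sTA] V'.subspace_add[OF sTA] V'.subspace_smult[OF sTA] subset_iff)
  moreover have "A \<subseteq> {x \<in> carrier V. T x \<in> V'.span (T ` A)}"
    using A V'.in_own_span[OF TA] by blast
  ultimately show "T ` span A \<subseteq> V'.span (T ` A)"
    using span_least by blast
  have sub: "x \<in> carrier V" if "x \<in> span A" for x using subspace_subset[OF sA] that by blast
  have "subspace K (T ` span A) V'"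
  proof (rule V'.subspaceI)
    show "T ` span A \<subseteq> carrier V'" using sub by blast
    show "\<zero>\<^bsub>V'\<^esub> \<in> T ` span A" by (rule image_eqI[of _ _ "\<zero>\<^bsub>V\<^esub>"]) (simp_all add: subspace_zero[OF sA])
    fix x y assume "x \<in> T ` span A" "y \<in> T ` span A"
    then obtain x' y' where *: "x' \<in> span A" "y' \<in> span A" "x = T x'" "y = T y'" by blast
    show "x \<oplus>\<^bsub>V'\<^esub> y \<in> T ` span A"
      by (rule image_eqI[of _ _ "x' \<oplus>\<^bsub>V\<^esub> y'"]) (use * sub in \<open>simp_all add: subspace_add[OF sA]\<close>)
  next
    fix a x assume a: "a \<in> carrier K" and "x \<in> T ` span A"
    then obtain x' where *: "x' \<in> span A" "x = T x'" by blast
    show "a \<odot>\<^bsub>V'\<^esub> x \<in> T ` span A"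
      by (rule image_eqI[of _ _ "a \<odot>\<^bsub>V\<^esub> x'"]) (use * a sub in \<open>simp_all add: subspace_smult[OF sA]\<close>)
  qed
  moreover have "T ` A \<subseteq> T ` span A" using in_own_span[OF A] by blast
  ultimately show "V'.span (T ` A) \<subseteq> T ` span A" by (rule V'.span_least)
qed

text \<open>Reconciles the two descriptions of points. Finiteness gives a one-dimensional subspace a
  finite basis, which then has a single, non-zero element. The result is applied to
  \<open>E\<close>, to its subspaces and to the quotient.\<close>

lemma proj_space_eq:
  fixes K :: "('a, 'k) ring_scheme" and E :: "('a, 'b) module"
  assumes "vectorspace K E" "finite (carrier E)"
  shows "proj_space K E = proj_points K E (carrier E)"
proof -
  interpret E: vectorspace K E by fact
  have "\<exists>v. L = E.span {v} \<and> v \<in> carrier E - {\<zero>\<^bsub>E\<^esub>}"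
    if L: "subspace K L E" "vectorspace.dim K (E\<lparr>carrier := L\<rparr>) = 1" for L
  proof -
    interpret L: vectorspace K "E\<lparr>carrier := L\<rparr>" using L(1) by (rule E.subspace_is_vs)
    have "finite L" using L(1) assms(2) E.subspace_subset finite_subset by blast
    then have "L.fin_dim" by (intro L.fin_dim_if_finite_carrier) simp
    then obtain B where B: "finite B" "L.basis B" using L.finite_basis_exists by blast
    then have "card B = 1" using L.dim_basis L(2) by simp
    then obtain v where v: "B = {v}" by (auto simp: card_1_singleton_iff)
    have "v \<in> L" using B(2) v by (simp add: L.basis_def)
    moreover have "v \<noteq> \<zero>\<^bsub>E\<^esub>"
      using L.vs_zero_lin_dep[of B] B(2) v by (auto simp: L.basis_def)
    moreover have "L = E.span {v}"
      using B(2) v \<open>v \<in> L\<close> E.span_vs[OF L(1), of "{v}"] by (simp add: L.basis_def)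
    ultimately show ?thesis using E.subspace_subset[OF L(1)] by blast
  qed
  then have "proj_space K E \<subseteq> proj_points K E (carrier E)"
    unfolding proj_space_def proj_points_def by blast
  moreover have "E.span {v} \<in> proj_space K E" if "v \<in> carrier E" "v \<noteq> \<zero>\<^bsub>E\<^esub>" for v
    unfolding proj_space_def
    using E.dim_vs_span_singleton[OF that] E.span_is_subspace[of "{v}"] that by blast
  ultimately show ?thesis
    unfolding proj_points_def by blast
qed

section \<open>Projectivizations and orthogonal complements\<close>

lemma (in q_matroid) finite_ground_space: "finite (carrier E)"
  using finite_field finite_dim by (rule finite_carrier)

lemma (in q_matroid) proj_space_eq_proj_points: "proj_space K E = proj_points K E (carrier E)"
  using vectorspace_axioms finite_ground_space by (rule proj_space_eq)

lemma (in q_matroid) Union_proj_space_subset: "A \<subseteq> proj_space K E \<Longrightarrow> \<Union>A \<subseteq> carrier E"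
  using subspace_subset by (auto simp: proj_space_def)

lemma (in q_matroid) is_matroid_projectivization: "is_matroid (projectivization K (E, \<rho>))"
proof -
  define S where "S = proj_space K E"
  define r where "r A = \<rho> (span (\<Union>A))" for A
  have carr: "\<Union>A \<subseteq> carrier E" if "A \<subseteq> S" for A
    using that Union_proj_space_subset by (simp add: S_def)
  have sub: "subspace K (span (\<Union>A)) E" if "A \<subseteq> S" for A
    using carr[OF that] by (rule span_is_subspace)
  have "S \<subseteq> Pow (carrier E)" using carr[of S] by blast
  then have fin: "finite S" using finite_ground_space by (meson finite_Pow_iff finite_subset)
  have "r A \<le> card A" if A: "A \<subseteq> S" for A
  proof -
    \<comment> \<open>Choose one generator \<open>u L\<close> for each line \<open>L\<close>. Then
      \<open>span (\<Union>A)\<close> lies in the span of at most \<open>card A\<close> vectors,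
      which bounds its rank.\<close>
    have "\<forall>L\<in>A. \<exists>u. u \<in> carrier E \<and> L = span {u}"
      using A by (auto simp: S_def proj_space_eq_proj_points proj_points_def)
    then obtain u where u: "\<And>L. L \<in> A \<Longrightarrow> u L \<in> carrier E" "\<And>L. L \<in> A \<Longrightarrow> L = span {u L}"
      by metis
    have uA: "u ` A \<subseteq> carrier E" using u(1) by blast
    have finA: "finite A" using A fin by (rule finite_subset)
    have "L \<subseteq> span (u ` A)" if "L \<in> A" for L
      using span_is_monotone[of "{u L}" "u ` A"] u(2)[OF that] that by blast
    then have "span (\<Union>A) \<subseteq> span (u ` A)"
      using uA by (intro span_least span_is_subspace) auto
    then have "\<rho> (span (\<Union>A)) \<le> \<rho> (span (u ` A))"
      using sub[OF A] span_is_subspace[OF uA] by (intro rank_mono)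
    also have "\<dots> \<le> vectorspace.dim K (E\<lparr>carrier := span (u ` A)\<rparr>)"
      using uA by (intro rank_le_dim span_is_subspace)
    also have "\<dots> \<le> card (u ` A)" using finA uA by (intro dim_vs_span_le) auto
    also have "\<dots> \<le> card A" using finA by (rule card_image_le)
    finally show ?thesis by (simp add: r_def)
  qed
  moreover have "r A \<le> r B" if "A \<subseteq> B" "B \<subseteq> S" for A B
    using that sub[of A] sub[of B] unfolding r_def
    by (intro rank_mono span_is_monotone) auto
  moreover have "r (A \<union> B) + r (A \<inter> B) \<le> r A + r B" if AB: "A \<subseteq> S" "B \<subseteq> S" for A B
  proof -
    have "span (\<Union>(A \<union> B)) = subspace_sum (span (\<Union>A)) (span (\<Union>B))"
      using span_union_is_sum[OF carr carr, OF AB] by (simp add: Union_Un_distrib)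
    \<comment> \<open>For unions the spans add up exactly, but here only an inclusion holds:
      disjoint sets of points may have overlapping spans. Monotonicity of \<open>\<rho>\<close>
      bridges the gap.\<close>
    moreover have "r (A \<inter> B) \<le> \<rho> (span (\<Union>A) \<inter> span (\<Union>B))"
      unfolding r_def
    proof (rule rank_mono)
      show "subspace K (span (\<Union>(A \<inter> B))) E" using AB by (intro sub) auto
      show "subspace K (span (\<Union>A) \<inter> span (\<Union>B)) E" using AB by (intro subspace_Int sub)
      show "span (\<Union>(A \<inter> B)) \<subseteq> span (\<Union>A) \<inter> span (\<Union>B)"
        by (intro Int_greatest span_is_monotone) auto
    qed
    ultimately show ?thesis
      using rank_submodular[OF sub sub, OF AB] by (simp add: r_def)
  qed
  ultimately have "is_matroid (S, r)"
    using fin by (simp add: is_matroid_def)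
  then show ?thesis by (simp add: projectivization_def S_def r_def[abs_def])
qed

section \<open>Double orthogonal complements over a finite field\<close>

context nondegenerate_symmetric_form
begin

lemma form_zero_right: "x \<in> carrier E \<Longrightarrow> \<beta> x \<zero>\<^bsub>E\<^esub> = \<zero>\<^bsub>K\<^esub>"
  using form_smult_right[of "\<zero>\<^bsub>K\<^esub>" x "\<zero>\<^bsub>E\<^esub>"] form_closed[of x "\<zero>\<^bsub>E\<^esub>"] by simp

lemma form_minus_left:
  assumes "x \<in> carrier E" "y \<in> carrier E" "z \<in> carrier E"
  shows "\<beta> (x \<ominus>\<^bsub>E\<^esub> y) z = \<beta> x z \<ominus>\<^bsub>K\<^esub> \<beta> y z"
proof -
  have "\<beta> (\<ominus>\<^bsub>E\<^esub> y) z = \<ominus>\<^bsub>K\<^esub> \<beta> y z"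
    using assms form_smult_left[of "\<ominus>\<^bsub>K\<^esub> \<one>\<^bsub>K\<^esub>" y z]
    by (simp add: smult_minus_1 form_closed R.l_minus)
  then show ?thesis
    using assms form_add_left[of x "\<ominus>\<^bsub>E\<^esub> y" z] by (simp add: a_minus_def)
qed

text \<open>Through \<open>span_least\<close>, this extends agreement of \<open>\<beta> x\<close>
  and \<open>\<beta> y\<close> from a basis to its span.\<close>

lemma subspace_form_eq:
  assumes "x \<in> carrier E" "y \<in> carrier E"
  shows "subspace K {z \<in> carrier E. \<beta> x z = \<beta> y z} E"
  using assms by (intro subspaceI) (auto simp: form_zero_right form_add_right form_smult_right)

lemma subspace_form_zero:
  assumes "x \<in> carrier E"
  shows "subspace K {z \<in> carrier E. \<beta> x z = \<zero>\<^bsub>K\<^esub>} E"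
  using assms by (intro subspaceI) (auto simp: form_zero_right form_add_right form_smult_right)

lemma form_separating:
  assumes x: "x \<in> carrier E" and y: "y \<in> carrier E"
    and eq: "\<And>z. z \<in> carrier E \<Longrightarrow> \<beta> x z = \<beta> y z"
  shows "x = y"
proof -
  have "x \<ominus>\<^bsub>E\<^esub> y = \<zero>\<^bsub>E\<^esub>"
    using x y by (intro form_nondegenerate) (auto simp: form_minus_left eq form_closed)
  then show ?thesis using x y by simp
qed

text \<open>
  The map sending \<open>y\<close> to the restriction of \<open>\<beta> y\<close> to \<open>B\<close> is injective by nondegeneracy, hence
  surjective because \<open>E\<close> and \<open>B \<rightarrow>\<^sub>E K\<close> have the same finite cardinality.
\<close>

lemma form_represents:
  assumes fin: "finite (carrier K)" and B: "finite B" "basis B"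
    and f: "f \<in> B \<rightarrow>\<^sub>E carrier K"
  obtains y where "y \<in> carrier E" "\<And>b. b \<in> B \<Longrightarrow> \<beta> y b = f b"
proof -
  have BE: "B \<subseteq> carrier E" and gen: "span B = carrier E" using B(2) by (auto simp: basis_def)
  define T where "T y = restrict (\<beta> y) B" for y
  have TE: "T ` carrier E \<subseteq> B \<rightarrow>\<^sub>E carrier K" using BE by (auto simp: T_def form_closed)
  have "inj_on T (carrier E)"
  proof (rule inj_onI)
    fix y z assume yz: "y \<in> carrier E" "z \<in> carrier E" and "T y = T z"
    then have "\<beta> y b = \<beta> z b" if "b \<in> B" for b
      using that by (metis T_def restrict_apply')
    then have "span B \<subseteq> {e \<in> carrier E. \<beta> y e = \<beta> z e}"
      using yz BE by (intro span_least subspace_form_eq) auto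
    then show "y = z" using yz by (intro form_separating) (auto simp: gen)
  qed
  then have "card (T ` carrier E) = card (B \<rightarrow>\<^sub>E carrier K)"
    using bij_betw_same_card[OF bij_betw_lincomb_basis[OF B(2,1)]] by (simp add: card_image)
  then have "T ` carrier E = B \<rightarrow>\<^sub>E carrier K"
    using TE fin B(1) by (intro card_subset_eq finite_PiE) auto
  then obtain y where "y \<in> carrier E" "f = T y" using f by blast
  then show ?thesis by (intro that[of y]) (auto simp: T_def)
qed

text \<open>The inclusion into \<open>U\<close> is by contraposition. If \<open>x\<close> is outside
  \<open>U\<close>, a basis of \<open>U\<close> together with \<open>x\<close> extends to a basis of
  \<open>E\<close>, and \<open>form_represents\<close> yields a \<open>y\<close> that is orthogonal
  to \<open>U\<close> but pairs to one with \<open>x\<close>.\<close>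

lemma orth_compl_orth_compl:
  assumes fin: "finite (carrier K)" and fd: "fin_dim" and U: "subspace K U E"
  shows "orth_compl K E \<beta> (orth_compl K E \<beta> U) = U"
proof
  show "U \<subseteq> orth_compl K E \<beta> (orth_compl K E \<beta> U)"
    using subspace_subset[OF U] by (auto simp: orth_compl_def form_sym subset_iff)
  show "orth_compl K E \<beta> (orth_compl K E \<beta> U) \<subseteq> U"
  proof
    fix x assume "x \<in> orth_compl K E \<beta> (orth_compl K E \<beta> U)"
    then have x: "x \<in> carrier E" and orth: "\<And>y. y \<in> orth_compl K E \<beta> U \<Longrightarrow> \<beta> x y = \<zero>\<^bsub>K\<^esub>"
      by (auto simp: orth_compl_def)
    show "x \<in> U"
    proof (rule ccontr)
      assume "x \<notin> U"
      interpret U: vectorspace K "E\<lparr>carrier := U\<rparr>" using U by (rule subspace_is_vs)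
      have "finite (carrier E)" using fin fd by (rule finite_carrier)
      then have "finite U" using subspace_subset[OF U] by (rule rev_finite_subset)
      then have "U.fin_dim" by (intro U.fin_dim_if_finite_carrier) simp
      then obtain C where C: "finite C" "U.basis C" using U.finite_basis_exists by blast
      then have CU: "C \<subseteq> U" by (simp add: U.basis_def)
      then have CE: "C \<subseteq> carrier E" using subspace_subset[OF U] by blast
      have "lin_indpt C"
        using C(2) span_li_not_depend(2)[OF CU] U by (simp add: U.basis_def)
      have spanC: "span C = U"
        using C(2) span_vs[OF U CU] by (simp add: U.basis_def)
      have "x \<notin> C" using CU \<open>x \<notin> U\<close> by blast
      then have "lin_indpt (C \<union> {x})"
        using lin_dep_iff_in_span[OF CE \<open>lin_indpt C\<close> x] spanC \<open>x \<notin> U\<close> by blast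
      then obtain B where B: "finite B" "C \<union> {x} \<subseteq> B" "basis B"
        using basis_extension[OF fd] CE x by (metis Un_subset_iff empty_subsetI insert_subset)
      \<comment> \<open>The coordinate functional of \<open>x\<close> on \<open>B\<close>; it
        vanishes on \<open>C\<close> because \<open>x\<close> is not in \<open>C\<close>.\<close>
      define f where "f = (\<lambda>b\<in>B. if b = x then \<one>\<^bsub>K\<^esub> else \<zero>\<^bsub>K\<^esub>)"
      have "f \<in> B \<rightarrow>\<^sub>E carrier K" by (auto simp: f_def)
      then obtain y where y: "y \<in> carrier E" "\<And>b. b \<in> B \<Longrightarrow> \<beta> y b = f b"
        using form_represents[OF fin B(1,3)] by blast
      have "\<beta> y c = \<zero>\<^bsub>K\<^esub>" if "c \<in> C" for c
        using y(2)[of c] that B(2) \<open>x \<notin> C\<close> by (auto simp: f_def)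
      then have "span C \<subseteq> {z \<in> carrier E. \<beta> y z = \<zero>\<^bsub>K\<^esub>}"
        using CE y(1) by (intro span_least subspace_form_zero) auto
      then have "y \<in> orth_compl K E \<beta> U"
        using y(1) by (auto simp: orth_compl_def spanC)
      then have "\<beta> y x = \<zero>\<^bsub>K\<^esub>" using orth form_sym x y(1) by metis
      moreover have "\<beta> y x = \<one>\<^bsub>K\<^esub>" using y(2)[of x] B(2) by (simp add: f_def)
      ultimately show False by simp
    qed
  qed
qed

end

section \<open>Quotient spaces\<close>

text \<open>Makes the coset calculus of abelian groups available for the quotient.\<close>

lemma (in vectorspace) subspace_abelian_subgroup:
  assumes "subspace K U V"
  shows "abelian_subgroup U V"
proof (rule abelian_subgroupI3)
  show "additive_subgroup U V"
    unfolding additive_subgroup_def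
    by (rule M.add.subgroupI)
      (use assms subspace_zero in \<open>auto simp: subspace_add subspace_uminus a_inv_def[symmetric] dest: subspace_subset\<close>)
qed (rule M.abelian_group_axioms)

section \<open>Cosets of a subspace, and the coset map as a linear map\<close>

context
  fixes K :: "('a, 'k) ring_scheme" and E :: "('a, 'b) module" and W :: "'b set"
  assumes E: "vectorspace K E" and W: "subspace K W E"
begin

interpretation E: vectorspace K E by (rule E)
interpretation W: abelian_subgroup W E by (rule E.subspace_abelian_subgroup[OF W])

lemma carrier_quotient_space: "carrier (quotient_space E W) = (\<lambda>x. W +>\<^bsub>E\<^esub> x) ` carrier E"
  by (auto simp: quotient_space_def A_RCOSETS_def')

lemma add_quotient_space:
  "x \<in> carrier E \<Longrightarrow> y \<in> carrier E \<Longrightarrow>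
    (W +>\<^bsub>E\<^esub> x) \<oplus>\<^bsub>quotient_space E W\<^esub> (W +>\<^bsub>E\<^esub> y) = W +>\<^bsub>E\<^esub> (x \<oplus>\<^bsub>E\<^esub> y)"
  by (simp add: quotient_space_def W.a_rcos_sum)

lemma zero_quotient_space: "\<zero>\<^bsub>quotient_space E W\<^esub> = W +>\<^bsub>E\<^esub> \<zero>\<^bsub>E\<^esub>"
  using E.subspace_subset[OF W] by (simp add: quotient_space_def)

lemma coset_eq_iff:
  assumes "x \<in> carrier E" "y \<in> carrier E"
  shows "W +>\<^bsub>E\<^esub> x = W +>\<^bsub>E\<^esub> y \<longleftrightarrow> (\<exists>w\<in>W. x = w \<oplus>\<^bsub>E\<^esub> y)"
proof -
  have "W +>\<^bsub>E\<^esub> x = W +>\<^bsub>E\<^esub> y \<longleftrightarrow> x \<in> W +>\<^bsub>E\<^esub> y"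
    using assms W.a_rcos_self W.a_repr_independence' by metis
  also have "\<dots> \<longleftrightarrow> (\<exists>w\<in>W. x = w \<oplus>\<^bsub>E\<^esub> y)"
    by (auto simp: a_r_coset_def')
  finally show ?thesis .
qed

text \<open>Changing the representative by some \<open>w\<close> in \<open>W\<close> changes its
  multiple by \<open>a\<close> times \<open>w\<close>, again in \<open>W\<close>. So all members of
  the defining union are the same coset.\<close>

lemma smult_quotient_space:
  assumes "a \<in> carrier K" "x \<in> carrier E"
  shows "a \<odot>\<^bsub>quotient_space E W\<^esub> (W +>\<^bsub>E\<^esub> x) = W +>\<^bsub>E\<^esub> (a \<odot>\<^bsub>E\<^esub> x)"
proof -
  have "W +>\<^bsub>E\<^esub> (a \<odot>\<^bsub>E\<^esub> y) = W +>\<^bsub>E\<^esub> (a \<odot>\<^bsub>E\<^esub> x)" if y: "y \<in> W +>\<^bsub>E\<^esub> x" for y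
  proof -
    obtain w where w: "w \<in> W" "y = w \<oplus>\<^bsub>E\<^esub> x" using y by (auto simp: a_r_coset_def')
    have "w \<in> carrier E" using w(1) E.subspace_subset[OF W] by blast
    then have "a \<odot>\<^bsub>E\<^esub> y = a \<odot>\<^bsub>E\<^esub> w \<oplus>\<^bsub>E\<^esub> a \<odot>\<^bsub>E\<^esub> x" "y \<in> carrier E"
      using assms w by (simp_all add: E.smult_r_distr)
    then show ?thesis
      using assms w(1) E.subspace_smult[OF W] by (subst coset_eq_iff) auto
  qed
  then have "(\<Union>y\<in>W +>\<^bsub>E\<^esub> x. W +>\<^bsub>E\<^esub> (a \<odot>\<^bsub>E\<^esub> y)) = (\<Union>y\<in>W +>\<^bsub>E\<^esub> x. W +>\<^bsub>E\<^esub> (a \<odot>\<^bsub>E\<^esub> x))"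
    by (rule SUP_cong[OF refl])
  \<comment> \<open>The index set is non-empty, since \<open>x\<close> lies in its own
    coset.\<close>
  also have "\<dots> = W +>\<^bsub>E\<^esub> (a \<odot>\<^bsub>E\<^esub> x)"
    using W.a_rcos_self[OF assms(2)] by (intro SUP_const) blast
  finally show ?thesis by (simp add: quotient_space_def)
qed

text \<open>The axioms are those of \<open>E\<close> read on representatives; the witness for the
  inverse of a coset is the coset of the negated representative.\<close>

lemma vectorspace_quotient_space: "vectorspace K (quotient_space E W)"
  by (rule vs_criteria[OF E.field_axioms])
    (auto simp: carrier_quotient_space add_quotient_space zero_quotient_space
      smult_quotient_space E.M.a_ac E.smult_assoc1 E.smult_l_distr E.smult_r_distr
      E.M.r_neg intro!: bexI[of _ "\<ominus>\<^bsub>E\<^esub> _"])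

lemma linear_map_coset: "linear_map K E (quotient_space E W) (\<lambda>x. W +>\<^bsub>E\<^esub> x)"
  unfolding linear_map_def mod_hom_def mod_hom_axioms_def module_hom_def
  using E vectorspace_quotient_space
  by (auto simp: carrier_quotient_space add_quotient_space smult_quotient_space
      vectorspace_def)

lemma coset_in_image_iff:
  assumes "U \<subseteq> carrier E" "x \<in> carrier E"
  shows "W +>\<^bsub>E\<^esub> x \<in> (\<lambda>x. W +>\<^bsub>E\<^esub> x) ` U \<longleftrightarrow> (\<exists>w\<in>W. \<exists>u\<in>U. x = w \<oplus>\<^bsub>E\<^esub> u)"
  using assms coset_eq_iff by (auto simp: image_iff subset_iff)

text \<open>Evaluates the preimages under the coset map by which \<open>q_contract\<close> defines
  its rank function.\<close>

lemma coset_vimage_image: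
  assumes "subspace K U E"
  shows "{x \<in> carrier E. W +>\<^bsub>E\<^esub> x \<in> (\<lambda>x. W +>\<^bsub>E\<^esub> x) ` U} = E.subspace_sum W U"
proof -
  have "x \<in> carrier E \<and> W +>\<^bsub>E\<^esub> x \<in> (\<lambda>x. W +>\<^bsub>E\<^esub> x) ` U \<longleftrightarrow> (\<exists>w\<in>W. \<exists>u\<in>U. x = w \<oplus>\<^bsub>E\<^esub> u)" for x
  proof (cases "x \<in> carrier E")
    case True
    then show ?thesis using coset_in_image_iff[OF E.subspace_subset[OF assms] True] by simp
  next
    \<comment> \<open>Both sides fail here, since sums of elements of \<open>W\<close> and
      \<open>U\<close> stay in the carrier.\<close>
    case False
    have "w \<oplus>\<^bsub>E\<^esub> u \<in> carrier E" if "w \<in> W" "u \<in> U" for w u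
      using that E.subspace_subset[OF assms] E.subspace_subset[OF W] by blast
    with False show ?thesis by blast
  qed
  moreover have "E.subspace_sum W U = {x. \<exists>w\<in>W. \<exists>u\<in>U. x = w \<oplus>\<^bsub>E\<^esub> u}"
    by (auto simp: E.submodule_sum_def)
  ultimately show ?thesis by simp
qed

end

section \<open>Contraction and deletion\<close>

context q_matroid
begin

lemma proj_points_mono: "U \<subseteq> U' \<Longrightarrow> proj_points K E U \<subseteq> proj_points K E U'"
  unfolding proj_points_def by blast

lemma proj_points_subset_proj_space: "subspace K U E \<Longrightarrow> proj_points K E U \<subseteq> proj_space K E"
  using proj_points_mono[OF subspace_subset] by (simp add: proj_space_eq_proj_points)

lemma Union_proj_points_subset:
  assumes "subspace K U E"
  shows "\<Union>(proj_points K E U) \<subseteq> U"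
proof -
  have "span {u} \<subseteq> U" if "u \<in> U" for u
    using that by (intro span_least[OF assms]) simp
  then show ?thesis unfolding proj_points_def by blast
qed

lemma proj_points_vs:
  assumes "subspace K U E"
  shows "proj_points K (E\<lparr>carrier := U\<rparr>) U = proj_points K E U"
proof -
  have "LinearCombinations.module.span K (E\<lparr>carrier := U\<rparr>) {u} = span {u}" if "u \<in> U" for u
    using that by (intro span_vs[OF assms]) simp
  then show ?thesis
    unfolding proj_points_def by (intro Collect_cong ex_cong1) auto
qed

text \<open>Spans do not depend on the ambient space, so the points of \<open>U\<close> as a space
  of its own are the points of \<open>E\<close> inside \<open>U\<close>.\<close>

lemma proj_space_vs:
  assumes U: "subspace K U E"
  shows "proj_space K (E\<lparr>carrier := U\<rparr>) = proj_points K E U"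
proof -
  have "finite U" using subspace_subset[OF U] finite_ground_space by (rule finite_subset)
  then show ?thesis
    using proj_space_eq[OF subspace_is_vs[OF U]] by (simp add: proj_points_vs[OF U])
qed

theorem projectivization_delete:
  assumes "nondegenerate_symmetric_form K E \<beta>" and V: "subspace K V E"
  shows "projectivization K (q_delete K \<beta> (E, \<rho>) (orth_compl K E \<beta> V)) \<cong>\<^sub>m
    matroid_delete (projectivization K (E, \<rho>)) (proj_space K E - proj_points K E V)"
proof -
  interpret \<beta>: nondegenerate_symmetric_form K E \<beta> by fact
  let ?N = "matroid_delete (projectivization K (E, \<rho>)) (proj_space K E - proj_points K E V)"
  have orth: "q_delete K \<beta> (E, \<rho>) (orth_compl K E \<beta> V) = (E\<lparr>carrier := V\<rparr>, \<rho>)"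
    by (simp add: q_delete_def \<beta>.orth_compl_orth_compl[OF finite_field finite_dim V])
  have N: "?N = (proj_points K E V, \<lambda>A. \<rho> (span (\<Union>A)))"
    using proj_points_subset_proj_space[OF V]
    by (auto simp: matroid_delete_def projectivization_def)
  have M: "projectivization K (E\<lparr>carrier := V\<rparr>, \<rho>) =
      (proj_points K E V, \<lambda>A. \<rho> (LinearCombinations.module.span K (E\<lparr>carrier := V\<rparr>) (\<Union>A)))"
    by (simp add: projectivization_def proj_space_vs[OF V])
  \<comment> \<open>The two rank functions use spans in different spaces but agree on sets of points
    of \<open>V\<close>; hence the identity is the equivalence.\<close>
  have span_eq: "LinearCombinations.module.span K (E\<lparr>carrier := V\<rparr>) (\<Union>A) = span (\<Union>A)"
    if "A \<subseteq> proj_points K E V" for A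
    using that Union_proj_points_subset[OF V] by (intro span_vs[OF V]) blast
  show ?thesis unfolding orth
  proof (rule matroid_equivI[where g = id])
    show "is_matroid ?N"
      by (intro is_matroid_delete is_matroid_projectivization)
  qed (auto simp: N M span_eq)
qed

text \<open>Formulated for any set \<open>S\<close> of points of \<open>W\<close> that spans
  \<open>W\<close>; the lines through a basis of \<open>W\<close> are the case of interest.\<close>

theorem projectivization_contract:
  assumes W: "subspace K W E" and V: "subspace K V E"
    and disj: "W \<inter> V = {\<zero>\<^bsub>E\<^esub>}" and sum: "subspace_sum W V = carrier E"
    and S: "S \<subseteq> proj_points K E W" and span_S: "span (\<Union>S) = W"
  shows "projectivization K (q_contract (E, \<rho>) W) \<cong>\<^sub>m
    matroid_delete (matroid_contract (projectivization K (E, \<rho>)) S)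
      (proj_space K E - proj_points K E V - S)"
proof -
  let ?N = "matroid_delete (matroid_contract (projectivization K (E, \<rho>)) S)
      (proj_space K E - proj_points K E V - S)"
  let ?P = "proj_points K E V"
  let ?Q = "quotient_space E W"
  define \<pi> where "\<pi> x = W +>\<^bsub>E\<^esub> x" for x
  have \<pi>_map: "linear_map K E ?Q \<pi>"
    unfolding \<pi>_def[abs_def] using vectorspace_axioms W by (rule linear_map_coset)
  interpret Q: vectorspace K ?Q
    using vectorspace_axioms W by (rule vectorspace_quotient_space)
  interpret \<pi>: linear_map K E ?Q \<pi> by (rule \<pi>_map)
  have WE: "W \<subseteq> carrier E" and VE: "V \<subseteq> carrier E"
    using W V by (simp_all add: subspace_subset)
  have carr_Q: "carrier ?Q = \<pi> ` carrier E"
    unfolding \<pi>_def[abs_def] using vectorspace_axioms W by (rule carrier_quotient_space)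
  have \<pi>_eq: "\<pi> x = \<pi> y \<longleftrightarrow> (\<exists>w\<in>W. x = w \<oplus>\<^bsub>E\<^esub> y)" if "x \<in> carrier E" "y \<in> carrier E" for x y
    unfolding \<pi>_def using vectorspace_axioms W that by (rule coset_eq_iff)
  have \<pi>_zero: "\<pi> x = \<zero>\<^bsub>?Q\<^esub> \<longleftrightarrow> x \<in> W" if "x \<in> carrier E" for x
    using \<pi>_eq[OF that zero_closed] WE by (auto simp: subset_iff)
  \<comment> \<open>The kernel of \<open>\<pi>\<close> is \<open>W\<close>, which meets
    \<open>V\<close> only in zero.\<close>
  have inj: "inj_on \<pi> V"
  proof (rule inj_onI)
    fix x y assume xy: "x \<in> V" "y \<in> V" "\<pi> x = \<pi> y"
    then have "\<pi> (x \<ominus>\<^bsub>E\<^esub> y) = \<zero>\<^bsub>?Q\<^esub>" and "x \<ominus>\<^bsub>E\<^esub> y \<in> carrier E"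
      using VE by (simp_all add: subset_iff)
    then have "x \<ominus>\<^bsub>E\<^esub> y \<in> W" using \<pi>_zero by blast
    moreover have "x \<ominus>\<^bsub>E\<^esub> y \<in> V"
      using xy V by (simp add: a_minus_def subspace_add subspace_uminus)
    ultimately have "x \<ominus>\<^bsub>E\<^esub> y = \<zero>\<^bsub>E\<^esub>" using disj by blast
    then show "x = y" using xy VE by (simp add: subset_iff)
  qed
  \<comment> \<open>A summand in \<open>W\<close> does not change the coset, so every coset has a
    representative in \<open>V\<close>.\<close>
  have surj: "\<pi> ` V = carrier ?Q"
  proof
    show "carrier ?Q \<subseteq> \<pi> ` V"
    proof
      fix X assume "X \<in> carrier ?Q"
      then obtain x where x: "x \<in> carrier E" "X = \<pi> x" by (auto simp: carr_Q)
      then have "x \<in> subspace_sum W V" by (simp add: sum)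
      then obtain w v where "w \<in> W" "v \<in> V" "x = w \<oplus>\<^bsub>E\<^esub> v"
        by (auto simp: submodule_sum_def)
      then show "X \<in> \<pi> ` V" using x \<pi>_eq[of x v] VE by blast
    qed
  qed (use VE carr_Q in blast)
  have image_line: "\<pi> ` span {v} = Q.span {\<pi> v}" if "v \<in> V" for v
    using image_span[OF \<pi>_map, of "{v}"] that VE by auto
  have line_sub: "L \<subseteq> V" if "L \<in> ?P" for L
    using Union_proj_points_subset[OF V] that by blast
  have bij: "bij_betw ((`) \<pi>) ?P (proj_space K ?Q)"
  proof (rule bij_betw_imageI)
    show "inj_on ((`) \<pi>) ?P"
      using inj_on_image_eq_iff[OF inj] line_sub by (intro inj_onI) blast
    have "finite (carrier ?Q)" using finite_ground_space by (simp add: carr_Q)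
    then have "proj_space K ?Q = proj_points K ?Q (\<pi> ` V)"
      using proj_space_eq[OF Q.vectorspace_axioms] by (simp add: surj)
    also have "\<dots> = {Q.span {\<pi> v} | v. v \<in> V - {\<zero>\<^bsub>E\<^esub>}}"
    proof -
      \<comment> \<open>Non-zero vectors of the quotient are thus the images of non-zero vectors of
        \<open>V\<close>, so points correspond to points.\<close>
      have "\<pi> v \<noteq> \<zero>\<^bsub>?Q\<^esub> \<longleftrightarrow> v \<noteq> \<zero>\<^bsub>E\<^esub>" if "v \<in> V" for v
        using \<pi>_zero[of v] that VE disj subspace_zero[OF W] by blast
      then have "\<pi> ` V - {\<zero>\<^bsub>?Q\<^esub>} = \<pi> ` (V - {\<zero>\<^bsub>E\<^esub>})" by blast
      then show ?thesis unfolding proj_points_def by auto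
    qed
    also have "\<dots> = (`) \<pi> ` ?P"
    proof -
      have "{Q.span {\<pi> v} | v. v \<in> V - {\<zero>\<^bsub>E\<^esub>}} = {\<pi> ` span {v} | v. v \<in> V - {\<zero>\<^bsub>E\<^esub>}}"
        using image_line by (intro Collect_cong ex_cong1) auto
      then show ?thesis unfolding proj_points_def by (simp only: setcompr_eq_image image_image)
    qed
    finally show "(`) \<pi> ` ?P = proj_space K ?Q" by simp
  qed
  \<comment> \<open>A common point would lie in \<open>W \<inter> V\<close>, yet it contains a
    non-zero vector.\<close>
  have "S \<inter> ?P = {}"
  proof -
    have False if L: "L \<in> S" "L \<in> ?P" for L
    proof -
      have "L \<subseteq> W" using Union_proj_points_subset[OF W] S L(1) by blast
      then have "L \<subseteq> {\<zero>\<^bsub>E\<^esub>}" using line_sub[OF L(2)] disj by blast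
      moreover obtain v where "v \<in> V" "v \<noteq> \<zero>\<^bsub>E\<^esub>" "L = span {v}"
        using L(2) by (auto simp: proj_points_def)
      ultimately show False using span_self[of v] VE by blast
    qed
    then show ?thesis by blast
  qed
  have SP: "S \<subseteq> proj_space K E" using S proj_points_subset_proj_space[OF W] by blast
  \<comment> \<open>Contraction removes \<open>S\<close> and deletion the remaining points outside
    \<open>V\<close>, so exactly \<open>?P\<close> is left. The subtracted rank of \<open>S\<close>
    is \<open>\<rho> W\<close>.\<close>
  have N: "?N = (?P, \<lambda>A. \<rho> (span (\<Union>(A \<union> S))) - \<rho> W)"
    using \<open>S \<inter> ?P = {}\<close> proj_points_subset_proj_space[OF V] SP span_S
    by (auto simp: matroid_delete_def matroid_contract_def projectivization_def)
  have M: "projectivization K (q_contract (E, \<rho>) W) =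
      (proj_space K ?Q, \<lambda>A. \<rho> {x \<in> carrier E. \<pi> x \<in> Q.span (\<Union>A)} - \<rho> W)"
    by (simp add: projectivization_def q_contract_def \<pi>_def)
  have rank: "{x \<in> carrier E. \<pi> x \<in> Q.span (\<Union>((`) \<pi> ` A))} = span (\<Union>(A \<union> S))" if "A \<subseteq> ?P" for A
  proof -
    have AE: "\<Union>A \<subseteq> carrier E" using that line_sub VE by blast
    have SE: "\<Union>S \<subseteq> carrier E" using SP by (rule Union_proj_space_subset)
    have "Q.span (\<Union>((`) \<pi> ` A)) = \<pi> ` span (\<Union>A)"
      using image_span[OF \<pi>_map AE] by (simp add: image_Union)
    then have "{x \<in> carrier E. \<pi> x \<in> Q.span (\<Union>((`) \<pi> ` A))} = subspace_sum W (span (\<Union>A))"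
      unfolding \<pi>_def[abs_def]
      using coset_vimage_image[OF vectorspace_axioms W span_is_subspace[OF AE]] by simp
    \<comment> \<open>Since \<open>W\<close> is the span of \<open>\<Union>S\<close>, the sum
      becomes one span, as in the rank of the contraction by \<open>S\<close>.\<close>
    also have "\<dots> = span (\<Union>(A \<union> S))"
      using span_union_is_sum[OF SE AE] by (simp add: span_S Union_Un_distrib Un_commute)
    finally show ?thesis .
  qed
  show ?thesis
  proof (rule matroid_equivI[where g = "(`) \<pi>"])
    show "is_matroid ?N"
      using SP by (intro is_matroid_delete is_matroid_contract is_matroid_projectivization)
        (simp add: projectivization_def)
  qed (use bij rank in \<open>auto simp: N M\<close>)
qed

end

section \<open>Specialization to the points spanned by a basis of \<open>W\<close>\<close>

theorem theorem3p8:
  fixes K :: "('a, 'k) ring_scheme" and E :: "('a, 'b) module"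
    and \<rho> :: "'b set \<Rightarrow> nat" and \<beta> :: "'b \<Rightarrow> 'b \<Rightarrow> 'a"
    and W V basis_W :: "'b set" and S Q\<^sub>V :: "'b set set"
  assumes "q_matroid K E \<rho>"
    and "nondegenerate_symmetric_form K E \<beta>"
    and "subspace K W E" and "subspace K V E"
    and "W \<inter> V = {\<zero>\<^bsub>E\<^esub>}" and "module.submodule_sum E W V = carrier E"
    and "vectorspace.basis K (E\<lparr>carrier := W\<rparr>) basis_W"
    and "S = {module.span K E {w} | w. w \<in> basis_W}"
    and "Q\<^sub>V = proj_space K E - proj_points K E V"
  shows "projectivization K (q_contract (E, \<rho>) W) \<cong>\<^sub>m
           matroid_delete (matroid_contract (projectivization K (E, \<rho>)) S) (Q\<^sub>V - S) \<and>
         projectivization K (q_delete K \<beta> (E, \<rho>) (orth_compl K E \<beta> V)) \<cong>\<^sub>m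
           matroid_delete (projectivization K (E, \<rho>)) Q\<^sub>V"
proof -
  interpret q_matroid K E \<rho> by fact
  interpret W: vectorspace K "E\<lparr>carrier := W\<rparr>"
    using \<open>subspace K W E\<close> by (rule subspace_is_vs)
  have WE: "W \<subseteq> carrier E" using assms(3) by (rule subspace_subset)
  have B: "W.basis basis_W" by fact
  then have BW: "basis_W \<subseteq> W" by (simp add: W.basis_def)
  have "\<zero>\<^bsub>E\<^esub> \<notin> basis_W"
    using W.vs_zero_lin_dep[of basis_W] B by (auto simp: W.basis_def)
  \<comment> \<open>Basis vectors are non-zero, so each of them spans a point of
    \<open>W\<close>.\<close>
  then have S: "S \<subseteq> proj_points K E W"
    using BW unfolding assms(8) proj_points_def by blast
  have "basis_W \<subseteq> \<Union>S" using span_self BW WE unfolding assms(8) by blast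
  \<comment> \<open>The basis generates \<open>W\<close> as a space of its own, and its span in
    \<open>E\<close> is the same.\<close>
  then have "W \<subseteq> span (\<Union>S)"
    using span_is_monotone B span_vs[OF assms(3) BW] by (auto simp: W.basis_def)
  moreover have "span (\<Union>S) \<subseteq> W"
    using S Union_proj_points_subset[OF assms(3)] by (intro span_least[OF assms(3)]) blast
  ultimately have "span (\<Union>S) = W" by blast
  then show ?thesis
    using projectivization_contract[OF assms(3-6) S] projectivization_delete[OF assms(2,4)]
    unfolding assms(9) by blast
qed

end
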